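(* Every topological field theory that has a standard basis is obtained from the standard topological field theory by perturbation. That is, let $K\ge0$ and let $v'_0,\dots,v'_K$ be nonzero complex numbers. Then there exist $\mu_0,\dots,\mu_K\in\mathbb{C}$ such that the correlation functions of the topological field theory with standard basis $\mathcal{O}_0,\dots,\mathcal{O}_K$ and sphere one-point functions $v'_\alpha$ coincide, in every genus $g\ge 0$ and for all insertions, with the perturbed correlation functions $\langle\,\cdot\,\rangle'_g$, with parameters $\mu_\alpha$, of the $K$-th standard topological field theory.
   Context: A topological field theory with standard basis $\mathcal{O}_0,\dots,\mathcal{O}_K$ and sphere one-point functions $v_0,\dots,v_K\in\mathbb{C}\setminus\{0\}$ consists of the commutative algebra $\tilde R=\bigoplus_{\alpha=0}^K\mathbb{C}\mathcal{O}_\alpha$ with product $\mathcal{O}_\alpha\mathcal{O}_\beta=\delta_{\alpha\beta}\mathcal{O}_\alpha$, the linear functional $\langle\,\cdot\,\rangle_0:\tilde R\to\mathbb{C}$ with $\langle\mathcal{O}_\alpha\rangle_0=v_\alpha$, and the genus-$g$ correlation functions $\langle a\rangle_g=\langle a\,H^g\rangle_0$ for $a\in\tilde R$ and $g\ge0$, where $H=\sum_\alpha \mathcal{O}_\alpha/v_\alpha$ is the handle operator (a correlation function of several operators is the correlation function of their product in $\tilde R$). The $K$-th standard topological field theory is the one with $v_\alpha=1$ for all $\alpha=0,\dots,K$. The perturbed genus-$g$ correlation functions with parameters $\mu_0,\dots,\mu_K\in\mathbb{C}$ are $$\langle a\rangle'_g=\Big\langle a\,\exp\Big\{(1-g)\sum_{\alpha}\mu_\alpha\mathcal{O}_\alpha\Big\}\Big\rangle_g,$$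 with the exponential taken in the algebra $\tilde R$. *)

theory Defs
  imports "HOL-Analysis.Analysis"
begin

(* The finite index type 'k plays the role of {0,...,K}, so CARD('k) = K + 1 with K >= 0
   arbitrary.  The algebra with standard basis is complex ^ 'k with the library's
   componentwise ring structure; its complex scalar multiplication is *s. *)

type_synonym 'k op_alg = "complex ^ 'k"

definition std_basis :: "'k::finite \<Rightarrow> 'k op_alg" where
  "std_basis \<alpha> = axis \<alpha> 1"

lemma std_basis_mult:
  "std_basis \<alpha> * std_basis \<beta> = (if \<alpha> = \<beta> then std_basis \<alpha> else 0)"
  by (auto simp: std_basis_def axis_def vec_eq_iff)

lemma std_basis_expansion: "(\<Sum>\<alpha>\<in>UNIV. (a $ \<alpha>) *s std_basis \<alpha>) = a"
  unfolding std_basis_def by (rule basis_expansion)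

(* A topological field theory with standard basis is given by its sphere one-point
   functions v; they are meant to be nonzero. *)

definition sphere_corr :: "('k::finite \<Rightarrow> complex) \<Rightarrow> 'k op_alg \<Rightarrow> complex" where
  "sphere_corr v a = (\<Sum>\<alpha>\<in>UNIV. a $ \<alpha> * v \<alpha>)"

lemma sphere_corr_add: "sphere_corr v (a + b) = sphere_corr v a + sphere_corr v b"
  by (simp add: sphere_corr_def distrib_right sum.distrib)

lemma sphere_corr_scale: "sphere_corr v (c *s a) = c * sphere_corr v a"
  by (simp add: sphere_corr_def sum_distrib_left mult.assoc)

lemma sphere_corr_std_basis: "sphere_corr v (std_basis \<alpha>) = v \<alpha>"
  by (simp add: sphere_corr_def std_basis_def axis_def if_distrib if_distribR cong: if_cong)

definition handle_op :: "('k::finite \<Rightarrow> complex) \<Rightarrow> 'k op_alg" where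
  "handle_op v = (\<Sum>\<alpha>\<in>UNIV. (1 / v \<alpha>) *s std_basis \<alpha>)"

definition corr :: "('k::finite \<Rightarrow> complex) \<Rightarrow> nat \<Rightarrow> 'k op_alg \<Rightarrow> complex" where
  "corr v g a = sphere_corr v (a * handle_op v ^ g)"

definition standard_tft :: "'k::finite \<Rightarrow> complex" where
  "standard_tft = (\<lambda>\<alpha>. 1)"

(* The library's exp is unavailable here: complex ^ 'k carries the Euclidean norm, in which
   the unit does not have norm 1, so it is not an instance of real_normed_algebra_1. *)

definition alg_exp :: "'k::finite op_alg \<Rightarrow> 'k op_alg" where
  "alg_exp a = (\<Sum>n. a ^ n /\<^sub>R fact n)"

lemma alg_exp_sums: "(\<lambda>n. a ^ n /\<^sub>R fact n) sums alg_exp a"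
proof -
  have pow: "(a ^ n) $ i = (a $ i) ^ n" for n i
    by (induction n) auto
  have "(\<lambda>n. a ^ n /\<^sub>R fact n) sums (\<chi> i. exp (a $ i))"
    unfolding sums_def
    by (rule vec_tendstoI) (use exp_converges in \<open>simp add: pow sums_def\<close>)
  then show ?thesis
    unfolding alg_exp_def by (simp add: sums_iff)
qed

definition perturbed_corr ::
  "('k::finite \<Rightarrow> complex) \<Rightarrow> ('k \<Rightarrow> complex) \<Rightarrow> nat \<Rightarrow> 'k op_alg \<Rightarrow> complex" where
  "perturbed_corr v \<mu> g a =
     corr v g (a * alg_exp ((1 - of_nat g) *s (\<Sum>\<alpha>\<in>UNIV. \<mu> \<alpha> *s std_basis \<alpha>)))"

end

(* The product of the algebra is componentwise, so exp of (1 - g) * sum of mu_a O_a has a-th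
   coordinate exp(mu_a) * exp(mu_a)^(-g), while the handle operator of the given theory
   contributes v'_a * (1 / v'_a)^g.  Any choice of logarithms mu_a of v'_a therefore works. *)
theory Submission
  imports Defs
begin

lemma vec_power_nth: "(a ^ n) $ i = (a $ i) ^ n"
  for a :: "'a::comm_semiring_1 ^ 'k::finite"
  by (induction n) auto

text \<open>Coordinate projection is bounded linear, so it passes through the exponential
  series.\<close>

lemma alg_exp_nth: "alg_exp a $ i = exp (a $ i)"
proof -
  have "(\<lambda>n. (a ^ n /\<^sub>R fact n) $ i) sums (alg_exp a $ i)"
    by (rule bounded_linear.sums[OF bounded_linear_vec_nth alg_exp_sums])
  then have "(\<lambda>n. (a $ i) ^ n /\<^sub>R fact n) sums (alg_exp a $ i)"
    by (simp add: vec_power_nth)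
  then show ?thesis
    using exp_converges sums_unique2 by blast
qed

lemma sum_std_basis_nth: "(\<Sum>\<alpha>\<in>UNIV. c \<alpha> *s std_basis \<alpha>) $ i = c i"
  using std_basis_expansion[of "\<chi> \<alpha>. c \<alpha>"] by simp

lemma corr_eq_sum: "corr v g a = (\<Sum>\<alpha>\<in>UNIV. a $ \<alpha> * (1 / v \<alpha>) ^ g * v \<alpha>)"
  \<comment> \<open>\<open>sum_component\<close> would push the coordinate into the basis sum before
    \<open>sum_std_basis_nth\<close> can match.\<close>
  by (simp add: corr_def sphere_corr_def handle_op_def vec_power_nth sum_std_basis_nth
      del: sum_component)

lemma perturbed_corr_eq_sum:
  "perturbed_corr v \<mu> g a =
     (\<Sum>\<alpha>\<in>UNIV. a $ \<alpha> * exp ((1 - of_nat g) * \<mu> \<alpha>) * (1 / v \<alpha>) ^ g * v \<alpha>)"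
  by (simp add: perturbed_corr_def corr_eq_sum alg_exp_nth sum_std_basis_nth left_diff_distrib
      del: sum_component)

text \<open>As g is a natural number, only true powers of \<open>exp z\<close> arise, so no branch
  of the logarithm matters.\<close>

lemma exp_one_minus_of_nat_mult: "exp ((1 - of_nat g) * z) = (1 / exp z) ^ g * exp z"
  for z :: complex
  by (simp add: left_diff_distrib exp_diff exp_of_nat_mult power_one_over)

theorem mainTheorem9:
  fixes v' :: "'k::finite \<Rightarrow> complex"
  assumes "\<And>\<alpha>. v' \<alpha> \<noteq> 0"
  shows "\<exists>\<mu> :: 'k \<Rightarrow> complex. \<forall>(g :: nat) (as :: 'k op_alg list).
           corr v' g (prod_list as) = perturbed_corr standard_tft \<mu> g (prod_list as)"
proof (intro exI allI)
  fix g and as :: "'k op_alg list"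
  show "corr v' g (prod_list as) =
          perturbed_corr standard_tft (\<lambda>\<alpha>. Ln (v' \<alpha>)) g (prod_list as)"
    \<comment> \<open>The standard weights are 1, so the exponential alone carries the genus;
      \<open>exp (Ln z) = z\<close> needs z nonzero.\<close>
    by (simp add: corr_eq_sum perturbed_corr_eq_sum standard_tft_def
        exp_one_minus_of_nat_mult assms mult.assoc)
qed

end
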